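(* Let $L_1,\dots,L_m\in\mathcal{L}_*$. If $\sum_{i=1}^m \phi_i(x) = 1$ for every $x \in \Omega$, then \[ \det \mathcal{I}L(x) = \prod_{i=1}^m \left( \det L_i \right)^{\phi_i(x)} \] for every $x \in \Omega$.
   Context: Let $n$ be a positive integer and $p,q\ge 0$ integers with $p+q=n$. Let $J=\mathrm{diag}(-1,\dots,-1,1,\dots,1)\in\mathbb{R}^{n\times n}$ with $p$ entries $-1$ and $q$ entries $1$. Let $\mathcal{L}$ be the set of nonsingular symmetric real $n\times n$ matrices with exactly $q$ positive and $p$ negative eigenvalues, and let $\mathcal{L}_*$ be the set of $L\in\mathcal{L}$ such that $LJ$ has no negative real eigenvalues. Let $\Omega\subset\mathbb{R}^d$ be a domain with points $x^{(1)},\dots,x^{(m)}\in\Omega$ and let $\phi_i:\Omega\to\mathbb{R}$, $i=1,\dots,m$, be functions satisfying $\phi_i(x^{(j)})=\delta_{ij}$. For matrices $L_1,\dots,L_m\in\mathcal{L}_*$ define the interpolant \[ \mathcal{I}L(x)=\exp\left(\sum_{i=1}^m\phi_i(x)\log(L_iJ)\right)J,\qquad x\in\Omega, \] where $\exp$ is the matrix exponential and $\log$ the principal matrix logarithm. Convention for powers: all $\det L_i$ have sign $(-1)^p$. A real power $a^s$ of a nonzero real number $a$ is the usual one if $a>0$, and is the principal complex power $a^s=|a|^s e^{i\pi s}$ if $a<0$. *)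

theory Defs
  imports "HOL-Analysis.Analysis" "HOL-Computational_Algebra.Polynomial"
begin

definition mat_eigenvalue :: "'a::field^'n^'n \<Rightarrow> 'a \<Rightarrow> bool" where
  "mat_eigenvalue A l \<longleftrightarrow> (\<exists>v. v \<noteq> 0 \<and> A *v v = l *s v)"

definition mat_char_poly :: "'a::field^'n^'n \<Rightarrow> 'a poly" where
  "mat_char_poly A = det (mat [:0, 1:] - map_matrix (\<lambda>a. [:a:]) A)"

text \<open>Eigenvalues are counted with (algebraic) multiplicity.\<close>

definition eigenvalue_count :: "real^'n^'n \<Rightarrow> real set \<Rightarrow> nat" where
  "eigenvalue_count A S = (\<Sum>l\<in>{l \<in> S. mat_eigenvalue A l}. order l (mat_char_poly A))"

text \<open>The index type is linearly ordered, so that the first \<open>p\<close> indices are those with fewer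
  than \<open>p\<close> indices below them.\<close>

definition J_mat :: "nat \<Rightarrow> real^'n::{finite,linorder}^'n::{finite,linorder}" where
  "J_mat p = (\<chi> i j. if i = j then (if card {k. k < i} < p then -1 else 1) else 0)"

definition sig_matrices :: "nat \<Rightarrow> nat \<Rightarrow> (real^'n^'n) set" where
  "sig_matrices p q = {L. invertible L \<and> transpose L = L \<and>
     eigenvalue_count L {0<..} = q \<and> eigenvalue_count L {..<0} = p}"

definition sig_matrices_star ::
  "nat \<Rightarrow> nat \<Rightarrow> (real^'n::{finite,linorder}^'n::{finite,linorder}) set" where
  "sig_matrices_star p q =
     {L \<in> sig_matrices p q. \<forall>l<0. \<not> mat_eigenvalue (L ** J_mat p) l}"

text \<open>The library's product and power on \<^typ>\<open>real^'n^'n\<close> are entrywise, so the exponential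
  series is built from \<^const>\<open>matrix_matrix_mult\<close>.\<close>

definition mat_exp :: "real^'n^'n \<Rightarrow> real^'n^'n" where
  "mat_exp A = (\<Sum>k. (((**) A ^^ k) (mat 1)) /\<^sub>R fact k)"

text \<open>A matrix without eigenvalues in the closed negative real axis has exactly one logarithm
  whose eigenvalues all lie in the open strip \<open>-\<pi> < Im z < \<pi>\<close>, its principal logarithm; for a real
  matrix it is real. The complex eigenvalues of the candidate \<open>X\<close> have to be considered here.\<close>

definition principal_log :: "real^'n^'n \<Rightarrow> real^'n^'n" where
  "principal_log A = (THE X. mat_exp X = A \<and>
     (\<forall>z. mat_eigenvalue (map_matrix complex_of_real X) z \<longrightarrow> -pi < Im z \<and> Im z < pi))"

definition interpolant ::
  "nat \<Rightarrow> nat \<Rightarrow> (nat \<Rightarrow> 'x \<Rightarrow> real)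
    \<Rightarrow> (nat \<Rightarrow> real^'n::{finite,linorder}^'n::{finite,linorder})
    \<Rightarrow> 'x \<Rightarrow> real^'n::{finite,linorder}^'n::{finite,linorder}" where
  "interpolant p m \<phi> L x =
     mat_exp (\<Sum>i=1..m. \<phi> i x *\<^sub>R principal_log (L i ** J_mat p)) ** J_mat p"

text \<open>Real powers of nonzero reals are principal complex powers, i.e. the complex \<open>powr\<close>:\<close>

lemma complex_powr_of_pos:
  assumes "a > 0"
  shows "complex_of_real a powr complex_of_real s = complex_of_real (a powr s)"
  using assms by (simp add: powr_of_real)

lemma complex_powr_of_neg:
  assumes "a < 0"
  shows "complex_of_real a powr complex_of_real s =
    complex_of_real (\<bar>a\<bar> powr s) * exp (\<i> * complex_of_real pi * complex_of_real s)"
proof -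
  have "Ln (complex_of_real a) = complex_of_real (ln \<bar>a\<bar>) + \<i> * complex_of_real pi"
    using Ln_minus[of "complex_of_real (-a)"] Ln_of_real[of "-a"] assms by simp
  then show ?thesis
    using assms by (simp add: powr_def ring_distribs exp_add mult_ac flip: exp_of_real)
qed

end

theory Submission
  imports Defs "HOL-Computational_Algebra.Fundamental_Theorem_Algebra"
begin

text \<open>If \<open>A\<close> has no eigenvalue in \<open>(-\<infinity>, 0]\<close>, its principal logarithm is
  \<open>X = \<integral> (A - 1) (1 + t (A - 1))\<inverse> dt\<close> over \<open>[0, 1]\<close>: differentiating the exponential of the partial
  integrals shows \<open>exp X = A\<close>, and \<open>X\<close> acts on a common eigenvector of \<open>A\<close> and \<open>X\<close> by \<open>Ln \<mu>\<close>. If \<open>Y\<close> is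
  another candidate, \<open>D = Y - X\<close> commutes with \<open>Y\<close> and \<open>exp D = 1\<close>, the strip condition leaves \<open>0\<close> as
  the only eigenvalue of \<open>D\<close>, and so \<open>D = 0\<close>. Hence \<open>mat_exp\<close> inverts \<open>principal_log\<close> at \<open>L\<^sub>i J\<close>, and
  \<open>det (exp X) = exp (trace X)\<close> turns the determinant of the interpolant into
  \<open>det J \<Prod> (det L\<^sub>i det J) powr \<phi>\<^sub>i\<close> with all bases positive. For \<open>det J = -1\<close> the factor \<open>det J\<close> is
  \<open>\<Prod> exp (\<i> \<pi> \<phi>\<^sub>i)\<close>, since the \<open>\<phi>\<^sub>i\<close> sum to \<open>1\<close>.\<close>

section \<open>Matrices as a Banach algebra\<close>

text \<open>A type of its own, because the product and the norm that the library puts on \<^typ>\<open>real^'n^'n\<close>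
  do not form a normed algebra with unit \<^term>\<open>mat 1\<close>.\<close>

typedef (overloaded) 'n sqmat = "UNIV :: (real^'n::finite^'n) set"
  morphisms mat_of_sq sq_of_mat ..

setup_lifting type_definition_sqmat

instantiation sqmat :: (finite) real_normed_algebra_1
begin

lift_definition zero_sqmat :: "'a sqmat" is 0 .
lift_definition one_sqmat :: "'a sqmat" is "mat 1" .
lift_definition plus_sqmat :: "'a sqmat \<Rightarrow> 'a sqmat \<Rightarrow> 'a sqmat" is "(+)" .
lift_definition minus_sqmat :: "'a sqmat \<Rightarrow> 'a sqmat \<Rightarrow> 'a sqmat" is "(-)" .
lift_definition uminus_sqmat :: "'a sqmat \<Rightarrow> 'a sqmat" is uminus .
lift_definition times_sqmat :: "'a sqmat \<Rightarrow> 'a sqmat \<Rightarrow> 'a sqmat" is "(**)" .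
lift_definition scaleR_sqmat :: "real \<Rightarrow> 'a sqmat \<Rightarrow> 'a sqmat" is "(*\<^sub>R)" .
text \<open>The operator norm is submultiplicative and gives the unit norm \<open>1\<close>, as the
  class requires.\<close>

lift_definition norm_sqmat :: "'a sqmat \<Rightarrow> real" is "\<lambda>A. onorm ((*v) A)" .

definition dist_sqmat :: "'a sqmat \<Rightarrow> 'a sqmat \<Rightarrow> real" where
  "dist_sqmat a b = norm (a - b)"
definition sgn_sqmat :: "'a sqmat \<Rightarrow> 'a sqmat" where
  "sgn_sqmat x = inverse (norm x) *\<^sub>R x"
definition uniformity_sqmat :: "('a sqmat \<times> 'a sqmat) filter" where
  "uniformity_sqmat = (INF e\<in>{0 <..}. principal {(x, y). dist x y < e})"
definition open_sqmat :: "'a sqmat set \<Rightarrow> bool" where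
  "open_sqmat S = (\<forall>x\<in>S. \<forall>\<^sub>F (x', y) in uniformity. x' = x \<longrightarrow> y \<in> S)"

instance
proof
  fix a b c :: "'a sqmat" and r s :: real
  show "a + b + c = a + (b + c)" "a + b = b + a" "0 + a = a" "- a + a = 0" "a - b = a + - b"
    by (transfer, simp)+
  show "r *\<^sub>R (a + b) = r *\<^sub>R a + r *\<^sub>R b" "(r + s) *\<^sub>R a = r *\<^sub>R a + s *\<^sub>R a"
    "r *\<^sub>R s *\<^sub>R a = (r * s) *\<^sub>R a" "1 *\<^sub>R a = a"
    by (transfer, simp add: algebra_simps)+
  show "a * b * c = a * (b * c)" "(a + b) * c = a * c + b * c" "a * (b + c) = a * b + a * c"
    "1 * a = a" "a * 1 = a"
    by (transfer, (simp add: matrix_mul_assoc matrix_add_ldistrib; fail |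
        simp add: vec_eq_iff matrix_matrix_mult_def distrib_right sum.distrib))+
  show "r *\<^sub>R a * b = r *\<^sub>R (a * b)" "a * r *\<^sub>R b = r *\<^sub>R (a * b)"
    by (transfer, simp add: matrix_scalar_ac scalar_matrix_assoc)+
  show "(0::'a sqmat) \<noteq> 1"
    by transfer (simp add: vec_eq_iff mat_def)
  show "dist a b = norm (a - b)" "sgn a = inverse (norm a) *\<^sub>R a"
    "(uniformity :: ('a sqmat \<times> 'a sqmat) filter) = (INF e\<in>{0 <..}. principal {(x, y). dist x y < e})"
    by (simp_all add: dist_sqmat_def sgn_sqmat_def uniformity_sqmat_def)
  show "open S = (\<forall>x\<in>S. \<forall>\<^sub>F (x', y) in uniformity. x' = x \<longrightarrow> y \<in> S)" for S :: "'a sqmat set"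
    by (simp add: open_sqmat_def)
  show "(norm a = 0) = (a = 0)"
    by transfer (simp add: onorm_eq_0 matrix_eq)
  show "norm (a + b) \<le> norm a + norm b"
  proof transfer
    fix A B :: "real^'a^'a"
    have "(*v) (A + B) = (\<lambda>v. A *v v + B *v v)"
      by (simp add: fun_eq_iff matrix_vector_mult_add_rdistrib)
    then show "onorm ((*v) (A + B)) \<le> onorm ((*v) A) + onorm ((*v) B)"
      by (simp add: onorm_triangle)
  qed
  show "norm (r *\<^sub>R a) = \<bar>r\<bar> * norm a"
  proof transfer
    fix A :: "real^'a^'a" and r :: real
    have "(*v) (r *\<^sub>R A) = (\<lambda>v. r *\<^sub>R (A *v v))"
      by (simp add: fun_eq_iff scaleR_matrix_vector_assoc)
    then show "onorm ((*v) (r *\<^sub>R A)) = \<bar>r\<bar> * onorm ((*v) A)"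
      by (simp add: onorm_scaleR)
  qed
  show "norm (a * b) \<le> norm a * norm b"
  proof transfer
    fix A B :: "real^'a^'a"
    have "(*v) (A ** B) = (*v) A \<circ> (*v) B"
      by (simp add: fun_eq_iff matrix_vector_mul_assoc)
    then show "onorm ((*v) (A ** B)) \<le> onorm ((*v) A) * onorm ((*v) B)"
      by (simp add: onorm_compose)
  qed
  show "norm (1 :: 'a sqmat) = 1"
  proof transfer
    have "(*v) (mat 1 :: real^'a^'a) = (\<lambda>v. v)"
      by (simp add: fun_eq_iff)
    then show "onorm ((*v) (mat 1 :: real^'a^'a)) = 1"
      by (simp add: onorm_id)
  qed
qed

end

text \<open>With the bound for the inverse map below, the two norms are equivalent, so limits,
  series and derivatives pass between the two types.\<close>

lemma bounded_linear_sq_of_mat: "bounded_linear (sq_of_mat :: real^'n^'n \<Rightarrow> 'n::finite sqmat)"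
proof (rule bounded_linear_intro)
  fix A B :: "real^'n^'n" and r :: real
  show "sq_of_mat (A + B) = sq_of_mat A + sq_of_mat B" "sq_of_mat (r *\<^sub>R A) = r *\<^sub>R sq_of_mat A"
    by (simp_all add: plus_sqmat.abs_eq scaleR_sqmat.abs_eq)
  have "\<bar>A $ i $ j\<bar> \<le> norm A" for i j
    by (metis Finite_Cartesian_Product.norm_nth_le order_trans real_norm_def)
  from onorm_le_matrix_component[OF this]
  show "norm (sq_of_mat A) \<le> norm A * (real CARD('n) * real CARD('n))"
    by (simp add: norm_sqmat.abs_eq ac_simps)
qed

lemma bounded_linear_mat_of_sq: "bounded_linear (mat_of_sq :: 'n::finite sqmat \<Rightarrow> real^'n^'n)"
proof (rule bounded_linear_intro)
  fix a b :: "'n sqmat" and r :: real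
  show "mat_of_sq (a + b) = mat_of_sq a + mat_of_sq b" "mat_of_sq (r *\<^sub>R a) = r *\<^sub>R mat_of_sq a"
    by (simp_all add: plus_sqmat.rep_eq scaleR_sqmat.rep_eq)
  have "norm (mat_of_sq a) \<le> (\<Sum>i\<in>UNIV. \<Sum>j\<in>UNIV. \<bar>mat_of_sq a $ i $ j\<bar>)"
    unfolding norm_vec_def[of "mat_of_sq a"]
    by (rule order_trans[OF L2_set_le_sum sum_mono]) (rule norm_ge_zero norm_le_l1_cart)+
  also have "\<dots> \<le> (\<Sum>i\<in>(UNIV::'n set). \<Sum>j\<in>(UNIV::'n set). norm a)"
    by (intro sum_mono) (simp add: norm_sqmat.rep_eq matrix_component_le_onorm)
  finally show "norm (mat_of_sq a) \<le> norm a * (real CARD('n) * real CARD('n))"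
    by (simp add: ac_simps)
qed

instance sqmat :: (finite) banach
proof
  fix X :: "nat \<Rightarrow> 'a sqmat"
  assume "Cauchy X"
  then have "convergent (\<lambda>n. mat_of_sq (X n))"
    by (intro Cauchy_convergent bounded_linear.Cauchy[OF bounded_linear_mat_of_sq])
  then obtain A where "(\<lambda>n. mat_of_sq (X n)) \<longlonglongrightarrow> A"
    by (auto simp: convergent_def)
  from bounded_linear.tendsto[OF bounded_linear_sq_of_mat this]
  show "convergent X"
    by (auto simp: convergent_def mat_of_sq_inverse)
qed

text \<open>Makes the theory of \<open>exp\<close> in Banach algebras available for
  \<open>mat_exp\<close>.\<close>

lemma mat_exp_eq: "mat_exp A = mat_of_sq (exp (sq_of_mat A))"
proof -
  have "((**) A ^^ k) (mat 1) = mat_of_sq (sq_of_mat A ^ k)" for k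
    by (induction k) (simp_all add: one_sqmat.rep_eq times_sqmat.rep_eq sq_of_mat_inverse)
  then show ?thesis
    unfolding mat_exp_def exp_def
    by (subst bounded_linear.suminf[OF bounded_linear_mat_of_sq summable_exp_generic])
       (simp add: scaleR_sqmat.rep_eq)
qed

section \<open>The logarithm as an integral\<close>

text \<open>The series beyond its first two terms is dominated by the scalar remainder
  \<open>exp (norm h) - 1 - norm h\<close>, which is at most \<open>norm h ^ 2\<close> for
  \<open>norm h < 1\<close>.\<close>

lemma exp_has_derivative_at_0:
  "((exp :: 'a::{real_normed_algebra_1,banach} \<Rightarrow> 'a) has_derivative (\<lambda>h. h)) (at 0)"
proof (rule has_derivativeI_sandwich[where e = 1])
  show "(norm \<longlongrightarrow> 0) (at (0::'a))"
    using tendsto_norm_zero[OF tendsto_ident_at[of "0::'a"]] by simp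
next
  fix h :: 'a
  assume h: "h \<noteq> 0" "dist h 0 < 1"
  let ?c = "\<lambda>n. inverse (fact (n + 2)) :: real"
  have *: "summable (\<lambda>n. ?c n *\<^sub>R norm h ^ (n + 2))"
    using summable_ignore_initial_segment[OF summable_exp_generic[of "norm h"], of 2] by simp
  have le: "norm (?c n *\<^sub>R h ^ (n + 2)) \<le> ?c n *\<^sub>R norm h ^ (n + 2)" for n
    by (simp add: mult_left_mono norm_power_ineq del: power_Suc fact_Suc add_2_eq_Suc')
  have "norm (exp h - exp 0 - (h - 0)) = norm (\<Sum>n. ?c n *\<^sub>R h ^ (n + 2))"
    by (subst exp_first_two_terms) simp
  also have "\<dots> \<le> (\<Sum>n. norm (?c n *\<^sub>R h ^ (n + 2)))"
    by (rule summable_norm summable_comparison_test'[OF *, of 0])+ (use le in simp)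
  also have "\<dots> \<le> (\<Sum>n. ?c n *\<^sub>R norm h ^ (n + 2))"
    by (rule suminf_le[OF le]) (rule summable_comparison_test'[OF *, of 0] *, use le in simp)+
  also have "\<dots> = exp (norm h) - 1 - norm h"
    by (subst exp_first_two_terms) simp
  also have "\<dots> \<le> (norm h)\<^sup>2"
    using exp_bound[of "norm h"] h by simp
  finally show "norm (exp h - exp 0 - (h - 0)) / norm (h - 0) \<le> norm h"
    using h by (simp add: field_simps power2_eq_square)
qed (auto intro: bounded_linear_ident)

text \<open>Commutation factors \<open>exp (x s)\<close> as
  \<open>exp (x t) * exp (x s - x t)\<close>, which leaves only the derivative of \<open>exp\<close>
  at \<open>0\<close>.\<close>

lemma has_vector_derivative_exp_commuting:
  fixes x :: "real \<Rightarrow> 'a::{real_normed_algebra_1,banach}"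
  assumes x: "(x has_vector_derivative d) (at t within S)"
    and comm: "\<And>s. s \<in> S \<Longrightarrow> x s * x t = x t * x s" and "t \<in> S"
  shows "((\<lambda>s. exp (x s)) has_vector_derivative exp (x t) * d) (at t within S)"
proof -
  have "((\<lambda>s. x s - x t) has_derivative (\<lambda>h. h *\<^sub>R d)) (at t within S)"
    using x unfolding has_vector_derivative_def by (auto intro!: derivative_eq_intros)
  then have "((\<lambda>s. exp (x s - x t)) has_vector_derivative d) (at t within S)"
    unfolding has_vector_derivative_def
    by (rule has_derivative_compose[where g = exp and g' = "\<lambda>h. h"]) (simp add: exp_has_derivative_at_0)
  then have "((\<lambda>s. exp (x t) * exp (x s - x t)) has_vector_derivative exp (x t) * d) (at t within S)"
    by (rule has_vector_derivative_mult_right)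
  then show ?thesis
  proof (rule has_vector_derivative_transform[rotated 2])
    fix s assume "s \<in> S"
    then have "x t * (x s - x t) = (x s - x t) * x t"
      by (simp add: comm algebra_simps)
    from exp_add_commuting[OF this] show "exp (x s) = exp (x t) * exp (x s - x t)"
      by simp
  qed fact
qed

text \<open>Here \<open>b t\<close> inverts the point at \<open>t\<close> of the segment from
  \<open>1\<close> to \<open>a\<close>. With \<open>x u\<close> the integral over
  \<open>{0..u}\<close>, the product of \<open>exp (- x u)\<close> and the segment point at
  \<open>u\<close> has derivative \<open>0\<close>. The last clause serves the uniqueness of the
  logarithm.\<close>

lemma exp_log_integral:
  fixes a :: "'a::{real_normed_algebra_1,banach}"
  assumes inv: "\<And>t. t \<in> {0..1} \<Longrightarrow> b t * (1 + t *\<^sub>R (a - 1)) = 1"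
      "\<And>t. t \<in> {0..1} \<Longrightarrow> (1 + t *\<^sub>R (a - 1)) * b t = 1"
  obtains x where "((\<lambda>t. (a - 1) * b t) has_integral x) {0..1}" "exp x = a"
    "\<And>y. y * a = a * y \<Longrightarrow> y * x = x * y"
proof -
  define f where "f t = (a - 1) * b t" for t
  define x where "x u = integral {0..u} f" for u :: real
  \<comment> \<open>The resolvent identity, obtained by inserting the two products that equal
    \<open>1\<close>; continuity of \<open>b\<close> rests on it.\<close>
  have diff: "b s - b t = (t - s) *\<^sub>R (b s * (a - 1) * b t)" if "s \<in> {0..1}" "t \<in> {0..1}" for s t
  proof -
    have "b s - b t = b s * ((1 + t *\<^sub>R (a - 1)) * b t) - (b s * (1 + s *\<^sub>R (a - 1))) * b t"
      using inv that by simp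
    also have "\<dots> = (t - s) *\<^sub>R (b s * (a - 1) * b t)"
      by (simp add: algebra_simps)
    finally show ?thesis .
  qed
  have cont_b: "continuous_on {0..1} b"
    unfolding continuous_on_def
  proof
    fix t :: real assume t: "t \<in> {0..1}"
    define K where "K = norm (a - 1) * norm (b t)"
    have K0: "K \<ge> 0" by (simp add: K_def)
    \<comment> \<open>Near \<open>t\<close> the identity bounds \<open>norm (b s - b t)\<close> by
      half of \<open>norm (b s)\<close>. Hence \<open>norm (b s) \<le> 2 * norm (b t)\<close>, which
      removes \<open>b s\<close> from the estimate.\<close>
    have bd: "norm (b s - b t) \<le> \<bar>t - s\<bar> * (2 * norm (b t) * K)"
      if s: "s \<in> {0..1}" and sm: "\<bar>t - s\<bar> * K \<le> 1 / 2" for s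
    proof -
      have "norm (b s * (a - 1) * b t) \<le> norm (b s) * norm (a - 1) * norm (b t)"
        by (meson norm_mult_ineq mult_right_mono norm_ge_zero order_trans)
      then have 1: "norm (b s - b t) \<le> \<bar>t - s\<bar> * (norm (b s) * K)"
        unfolding diff[OF s t] K_def by (simp add: mult_left_mono mult.assoc)
      have "\<bar>t - s\<bar> * (norm (b s) * K) = norm (b s) * (\<bar>t - s\<bar> * K)"
        by simp
      also have "\<dots> \<le> norm (b s) * (1 / 2)"
        by (intro mult_left_mono sm) simp
      finally have "norm (b s - b t) \<le> norm (b s) / 2"
        using 1 by simp
      then have "norm (b s) \<le> 2 * norm (b t)"
        using norm_triangle_sub[of "b s" "b t"] by simp
      then have "\<bar>t - s\<bar> * (norm (b s) * K) \<le> \<bar>t - s\<bar> * (2 * norm (b t) * K)"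
        by (intro mult_left_mono mult_right_mono K0) auto
      with 1 show ?thesis by simp
    qed
    have "((\<lambda>s. \<bar>t - s\<bar> * K) \<longlongrightarrow> 0) (at t within {0..1})"
      by (auto intro!: tendsto_eq_intros)
    then have "eventually (\<lambda>s. \<bar>t - s\<bar> * K < 1 / 2) (at t within {0..1})"
      by (rule order_tendstoD) simp
    then have "eventually (\<lambda>s. norm (b s - b t) \<le> \<bar>t - s\<bar> * (2 * norm (b t) * K)) (at t within {0..1})"
      using bd unfolding eventually_at_filter by (auto elim!: eventually_mono)
    moreover have "((\<lambda>s. \<bar>t - s\<bar> * (2 * norm (b t) * K)) \<longlongrightarrow> 0) (at t within {0..1})"
      by (auto intro!: tendsto_eq_intros)
    ultimately have "((\<lambda>s. b s - b t) \<longlongrightarrow> 0) (at t within {0..1})"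
      by (rule Lim_null_comparison)
    then show "(b \<longlongrightarrow> b t) (at t within {0..1})"
      by (rule LIM_zero_cancel)
  qed
  have cont: "continuous_on {0..1} f"
    unfolding f_def by (intro continuous_intros cont_b)
  have comm_f: "y * f t = f t * y" if y: "y * a = a * y" and t: "t \<in> {0..1}" for y t
  proof -
    \<comment> \<open>Multiplying by \<open>b t\<close> on both sides carries the commutation of
      \<open>y\<close> over from the segment point to its inverse.\<close>
    have "b t * (y * (1 + t *\<^sub>R (a - 1))) * b t = b t * ((1 + t *\<^sub>R (a - 1)) * y) * b t"
      by (simp add: y algebra_simps)
    moreover have "b t * (y * (1 + t *\<^sub>R (a - 1))) * b t = b t * y"
      using inv(2)[OF t] by (simp add: mult.assoc)
    moreover have "b t * ((1 + t *\<^sub>R (a - 1)) * y) * b t = y * b t"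
      using inv(1)[OF t] by (simp add: mult.assoc[symmetric])
    ultimately have "b t * y = y * b t" by simp
    then show ?thesis
      unfolding f_def by (simp add: algebra_simps y) (metis mult.assoc y)
  qed
  have int: "f integrable_on {0..u}" if "u \<in> {0..1}" for u
    using that by (intro integrable_continuous_real continuous_on_subset[OF cont]) auto
  have comm_gen: "y * x u = x u * y" if y: "\<And>t. t \<in> {0..1} \<Longrightarrow> y * f t = f t * y" and u: "u \<in> {0..1}" for y u
  proof -
    have i: "(f has_integral x u) {0..u}"
      unfolding x_def using int[OF u] by (rule integrable_integral)
    have "((\<lambda>t. y * f t) has_integral y * x u) {0..u}"
      using has_integral_linear[OF i bounded_linear_mult_right[of y]] by (simp add: o_def)
    moreover have "((\<lambda>t. f t * y) has_integral x u * y) {0..u}"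
      using has_integral_linear[OF i bounded_linear_mult_left[of y]] by (simp add: o_def)
    then have "((\<lambda>t. y * f t) has_integral x u * y) {0..u}"
      by (rule has_integral_eq[rotated]) (use y u in auto)
    ultimately show ?thesis by (rule has_integral_unique)
  qed
  have comm_x: "y * x u = x u * y" if "y * a = a * y" "u \<in> {0..1}" for y u
    using comm_gen comm_f that by blast
  \<comment> \<open>\<open>a\<close> commutes with itself, hence with \<open>x u\<close>; so
    \<open>x u\<close> commutes with each \<open>f t\<close> and with the integral
    \<open>x v\<close>.\<close>
  have comm_xx: "x u * x v = x v * x u" if "u \<in> {0..1}" "v \<in> {0..1}" for u v
    using comm_f[of "x u"] comm_x[of a] that by (intro comm_gen) auto
  have dx: "(x has_vector_derivative f t) (at t within {0..1})" if "t \<in> {0..1}" for t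
    unfolding x_def using integral_has_vector_derivative[OF cont that] .
  have "((\<lambda>t. exp (- x t) * (1 + t *\<^sub>R (a - 1))) has_vector_derivative 0) (at t within {0..1})"
    if t: "t \<in> {0..1}" for t
  proof -
    have 1: "((\<lambda>t. exp (- x t)) has_vector_derivative exp (- x t) * (- f t)) (at t within {0..1})"
      by (rule has_vector_derivative_exp_commuting)
         (use comm_xx t in \<open>auto intro!: has_vector_derivative_minus dx\<close>)
    have 2: "((\<lambda>t. 1 + t *\<^sub>R (a - 1)) has_vector_derivative (a - 1)) (at t within {0..1})"
      by (auto intro!: derivative_eq_intros)
    have "f t * (1 + t *\<^sub>R (a - 1)) = a - 1"
      unfolding f_def using inv(1)[OF t] by (simp add: mult.assoc)
    then show ?thesis
      using has_vector_derivative_mult[OF 1 2] by (simp add: mult.assoc)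
  qed
  then obtain c where c: "\<And>t. t \<in> {0..1} \<Longrightarrow> exp (- x t) * (1 + t *\<^sub>R (a - 1)) = c"
    using has_vector_derivative_zero_constant[of "{0..1::real}"] by blast
  \<comment> \<open>At \<open>t = 0\<close> the constant is \<open>1\<close>, because
    \<open>x 0\<close> is an integral over a single point.\<close>
  have "exp (- x 1) * a = 1"
    using c[of 0] c[of 1] by (simp add: x_def)
  then have "exp (x 1) * (exp (- x 1) * a) = exp (x 1)" by simp
  then have "exp (x 1) = a"
    by (simp add: mult.assoc[symmetric] exp_minus_inverse)
  moreover have "(f has_integral x 1) {0..1}"
    unfolding x_def using int[of 1] by (intro integrable_integral) auto
  ultimately show ?thesis
    using that comm_x[of _ 1] unfolding f_def by auto
qed

section \<open>Complex eigenvectors\<close>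

text \<open>The first \<open>CARD('n) + 1\<close> iterates of \<open>D\<close> on \<open>v\<close>
  are linearly dependent; the coefficients of a dependence form \<open>p\<close>.\<close>

lemma exists_annihilating_poly:
  fixes D :: "complex^'n^'n" and v :: "complex^'n"
  shows "\<exists>p N. p \<noteq> 0 \<and> degree p \<le> N \<and> (\<Sum>i\<le>N. coeff p i *s ((*v) D ^^ i) v) = 0"
proof -
  define N where "N = CARD('n)"
  define f where "f i = ((*v) D ^^ i) v" for i
  show ?thesis
  proof (cases "inj_on f {..N}")
    \<comment> \<open>\<open>vec.dependent\<close> speaks of sets, so a repeated iterate is treated
      separately, by a difference of two monomials.\<close>
    case False
    then obtain i j where ij: "i \<le> N" "j \<le> N" "i \<noteq> j" "f i = f j"
      by (auto simp: inj_on_def)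
    define p :: "complex poly" where "p = monom 1 i - monom 1 j"
    have "coeff p i = 1"
      using ij by (simp add: p_def)
    then have "p \<noteq> 0" by auto
    moreover have "degree p \<le> N"
      unfolding p_def using ij by (intro degree_diff_le) (auto intro: order_trans[OF degree_monom_le])
    moreover have "(\<Sum>k\<le>N. coeff p k *s f k) = f i - f j"
    proof -
      have "(\<Sum>k\<le>N. coeff p k *s f k) = (\<Sum>k\<le>N. (if k = i then f k else 0) - (if k = j then f k else 0))"
        by (intro sum.cong) (auto simp: p_def vec_eq_iff)
      also have "\<dots> = f i - f j"
        using ij by (simp add: sum_subtractf)
      finally show ?thesis .
    qed
    ultimately show ?thesis
      using ij unfolding f_def by auto
  next
    case True
    then have "card (f ` {..N}) = Suc N"
      by (simp add: card_image)
    then have "vec.dim (f ` {..N}) < card (f ` {..N})"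
      using dim_subset_UNIV_cart_gen[of "f ` {..N}"] by (simp add: N_def)
    then have "vec.dependent (f ` {..N})"
      by (intro vec.dependent_biggerset_general) auto
    then obtain u w where u: "w \<in> f ` {..N}" "u w \<noteq> 0" "(\<Sum>w\<in>f ` {..N}. u w *s w) = 0"
      by (auto simp: vec.dependent_finite)
    define p where "p = (\<Sum>i\<le>N. monom (u (f i)) i)"
    have cp: "coeff p i = u (f i)" if "i \<le> N" for i
      using that by (simp add: p_def coeff_sum)
    from u obtain i where "i \<le> N" "u (f i) \<noteq> 0" by auto
    then have "p \<noteq> 0"
      using cp[of i] by auto
    moreover have "degree p \<le> N"
      unfolding p_def by (intro degree_sum_le) (auto intro: order_trans[OF degree_monom_le])
    moreover have "(\<Sum>i\<le>N. coeff p i *s f i) = 0"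
      using u(3) True by (simp add: sum.reindex cp)
    ultimately show ?thesis
      unfolding f_def by blast
  qed
qed

text \<open>Split a root \<open>l\<close> off \<open>p\<close>, leaving \<open>r\<close>. Either
  \<open>v\<close> is an eigenvector for \<open>l\<close>, or \<open>r\<close>, of smaller degree,
  annihilates the nonzero vector \<open>D *v v - l *s v\<close>, which lies in \<open>S\<close>
  again.\<close>

lemma exists_eigenvector_of_annihilating_poly:
  fixes D :: "complex^'n^'n" and S :: "(complex^'n) set"
  assumes inv: "\<And>w l. w \<in> S \<Longrightarrow> D *v w - l *s w \<in> S"
  shows "p \<noteq> 0 \<Longrightarrow> degree p \<le> N \<Longrightarrow> (\<Sum>i\<le>N. coeff p i *s ((*v) D ^^ i) v) = 0 \<Longrightarrow>
    v \<in> S \<Longrightarrow> v \<noteq> 0 \<Longrightarrow> \<exists>w\<in>S. \<exists>l. w \<noteq> 0 \<and> D *v w = l *s w"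
proof (induction "degree p" arbitrary: p v)
  case 0
  then obtain c where c: "p = [:c:]" "c \<noteq> 0"
    by (metis degree_eq_zeroE pCons_0_0)
  have "(\<Sum>i\<le>N. coeff p i *s ((*v) D ^^ i) v) = (\<Sum>i\<le>N. if i = 0 then c *s v else 0)"
    by (intro sum.cong) (auto simp: c coeff_pCons split: nat.split)
  also have "\<dots> = c *s v" by simp
  finally show ?case
    using 0 c by simp
next
  case (Suc d)
  then have "\<not> constant (poly p)"
    by (simp add: constant_degree)
  then obtain l where "poly p l = 0"
    using fundamental_theorem_of_algebra by blast
  then obtain r where r: "p = [:-l, 1:] * r"
    by (metis dvdE poly_eq_0_iff_dvd)
  with Suc have "r \<noteq> 0" by auto
  then have deg: "degree p = Suc (degree r)"
    unfolding r by (subst degree_mult_eq) auto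
  define w where "w = D *v v - l *s v"
  show ?case
  proof (cases "w = 0")
    case True
    then show ?thesis
      using Suc.prems by (auto simp: w_def)
  next
    case False
    have pow: "((*v) D ^^ i) w = ((*v) D ^^ Suc i) v - l *s ((*v) D ^^ i) v" for i
      by (induction i) (simp_all add: w_def vec.diff vec.scale)
    let ?g = "\<lambda>i. ((*v) D ^^ i) v"
    \<comment> \<open>The degree of \<open>r\<close> is below \<open>N\<close>, so shifting the sum
      by one index loses no term.\<close>
    have cr: "coeff r N = 0"
      using deg Suc.prems by (intro coeff_eq_0) auto
    obtain M where M: "N = Suc M"
      using deg Suc.prems by (cases N) auto
    have cp: "coeff p i = (if i = 0 then 0 else coeff r (i - 1)) - l * coeff r i" for i
      unfolding r by (cases i) simp_all
    have "(\<Sum>i\<le>N. coeff r i *s ((*v) D ^^ i) w) =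
        (\<Sum>i\<le>N. coeff r i *s ?g (Suc i)) - (\<Sum>i\<le>N. (l * coeff r i) *s ?g i)"
      unfolding pow sum_subtractf[symmetric]
      by (intro sum.cong) (auto simp: vec_eq_iff algebra_simps)
    also have "(\<Sum>i\<le>N. coeff r i *s ?g (Suc i)) = (\<Sum>i\<le>N. (if i = 0 then 0 else coeff r (i - 1)) *s ?g i)"
      using cr unfolding M by (subst (2) sum.atMost_Suc_shift) simp
    also have "\<dots> - (\<Sum>i\<le>N. (l * coeff r i) *s ?g i) = (\<Sum>i\<le>N. coeff p i *s ?g i)"
      unfolding cp sum_subtractf[symmetric]
      by (intro sum.cong) (auto simp: vec_eq_iff algebra_simps)
    finally have "(\<Sum>i\<le>N. coeff r i *s ((*v) D ^^ i) w) = 0"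
      using Suc.prems by simp
    moreover have "w \<in> S"
      unfolding w_def using Suc.prems by (intro inv)
    moreover have "d = degree r" "degree r \<le> N"
      using deg Suc by auto
    ultimately show ?thesis
      using Suc.hyps(1)[of r w] False \<open>r \<noteq> 0\<close> by simp
  qed
qed

text \<open>Applied below to an eigenspace of a commuting matrix and to a range.\<close>

lemma invariant_set_has_eigenvector:
  fixes D :: "complex^'n^'n" and S :: "(complex^'n) set"
  assumes "\<And>w l. w \<in> S \<Longrightarrow> D *v w - l *s w \<in> S" "v \<in> S" "v \<noteq> 0"
  obtains w l where "w \<in> S" "w \<noteq> 0" "D *v w = l *s w"
proof -
  obtain p N where "p \<noteq> 0" "degree p \<le> N" "(\<Sum>i\<le>N. coeff p i *s ((*v) D ^^ i) v) = 0"
    using exists_annihilating_poly by blast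
  from exists_eigenvector_of_annihilating_poly[OF assms(1) this assms(2,3)] show ?thesis
    using that by blast
qed

text \<open>Real matrices act on complex vectors, so that complex eigenvalues need no second matrix algebra.\<close>

definition cact :: "'n::finite sqmat \<Rightarrow> complex^'n \<Rightarrow> complex^'n" where
  "cact x v = map_matrix complex_of_real (mat_of_sq x) *v v"

lemma bounded_linear_cact: "bounded_linear (\<lambda>x. cact x (v :: complex^'n::finite))"
proof -
  have "linear (\<lambda>A :: real^'n^'n. map_matrix complex_of_real A *v (v :: complex^'n))"
    by (rule linearI)
       (simp_all add: vec_eq_iff matrix_vector_mult_def algebra_simps sum.distrib sum_distrib_left
         scaleR_conv_of_real[where 'a = complex])
  then have "bounded_linear (\<lambda>A :: real^'n^'n. map_matrix complex_of_real A *v (v :: complex^'n))"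
    by (simp add: linear_conv_bounded_linear)
  from bounded_linear_compose[OF this bounded_linear_mat_of_sq] show ?thesis
    unfolding cact_def .
qed

lemma cact_0 [simp]: "cact 0 v = 0"
  and cact_add: "cact (x + y) v = cact x v + cact y v"
  and cact_diff: "cact (x - y) v = cact x v - cact y v"
  and cact_scaleR: "cact (r *\<^sub>R x) v = complex_of_real r *s cact x v"
proof -
  interpret bounded_linear "\<lambda>x. cact x v" by (rule bounded_linear_cact)
  show "cact 0 v = 0" "cact (x + y) v = cact x v + cact y v" "cact (x - y) v = cact x v - cact y v"
    by (simp_all add: zero add diff)
  show "cact (r *\<^sub>R x) v = complex_of_real r *s cact x v"
    unfolding scaleR by (simp add: vec_eq_iff scaleR_conv_of_real[where 'a = complex])
qed

lemma cact_right [simp]: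
  "cact x (v + w) = cact x v + cact x w" "cact x (v - w) = cact x v - cact x w"
  "cact x (c *s v) = c *s cact x v" "cact x 0 = 0"
  by (simp_all add: cact_def vec.add vec.diff vec.scale)

lemma cact_1 [simp]: "cact 1 (v :: complex^'n::finite) = v"
proof -
  have "map_matrix complex_of_real (mat 1 :: real^'n^'n) = mat 1"
    by (simp add: vec_eq_iff mat_def)
  then show ?thesis by (simp add: cact_def one_sqmat.rep_eq)
qed

lemma cact_mult: "cact (x * y) v = cact x (cact y (v :: complex^'n::finite))"
proof -
  have "map_matrix complex_of_real (A ** B) = map_matrix complex_of_real A ** map_matrix complex_of_real B"
    for A B :: "real^'n^'n"
    by (simp add: vec_eq_iff matrix_matrix_mult_def)
  then show ?thesis
    by (simp add: cact_def times_sqmat.rep_eq matrix_vector_mul_assoc)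
qed

lemma cact_eqI:
  assumes "\<And>v. cact x v = 0"
  shows "x = 0"
proof -
  have "map_matrix complex_of_real (mat_of_sq x) = 0"
    using assms by (simp add: cact_def matrix_eq)
  then have "mat_of_sq x = 0"
    by (simp add: vec_eq_iff)
  then show ?thesis
    by (metis mat_of_sq_inject zero_sqmat.rep_eq)
qed

text \<open>As \<open>x\<close> and \<open>y\<close> commute, \<open>y\<close> preserves the
  eigenspace of \<open>x\<close> for \<open>l\<close> and so has an eigenvector in it.\<close>

lemma exists_common_eigenvector:
  assumes "x * y = y * x" "v \<noteq> 0" "cact x v = l *s v"
  obtains w m where "w \<noteq> 0" "cact x w = l *s w" "cact y w = m *s w"
proof -
  have "cact x (cact y w - c *s w) = l *s (cact y w - c *s w)" if "cact x w = l *s w" for w c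
  proof -
    have "cact x (cact y w) = cact y (cact x w)"
      using assms(1) by (metis cact_mult)
    then show ?thesis
      using that by (simp add: vec_eq_iff algebra_simps)
  qed
  then obtain w m where "w \<in> {w. cact x w = l *s w}" "w \<noteq> 0" "cact y w = m *s w"
    using invariant_set_has_eigenvector[of "{w. cact x w = l *s w}"
      "map_matrix complex_of_real (mat_of_sq y)" v] assms(2,3)
    unfolding cact_def[of y] by blast
  then show ?thesis
    using that by blast
qed

lemma cact_exp:
  assumes "cact x v = l *s v"
  shows "cact (exp x) v = exp l *s v"
proof -
  have "cact (x ^ k) v = l ^ k *s v" for k
    by (induction k) (simp_all add: cact_mult assms)
  then have *: "cact (x ^ k /\<^sub>R fact k) v = (l ^ k /\<^sub>R fact k) *s v" for k
    by (simp add: cact_scaleR scaleR_conv_of_real[of _ "l ^ k"])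
  have lin: "bounded_linear (\<lambda>c :: complex. c *s v)"
    by (rule linear_conv_bounded_linear[THEN iffD1, OF linearI])
       (simp_all add: vec_eq_iff algebra_simps)
  have "(\<lambda>k. cact (x ^ k /\<^sub>R fact k) v) sums cact (exp x) v"
    "(\<lambda>k. (l ^ k /\<^sub>R fact k) *s v) sums (exp l *s v)"
    using bounded_linear.sums[OF bounded_linear_cact exp_converges[of x], of v]
      bounded_linear.sums[OF lin exp_converges[of l]] .
  then show ?thesis
    unfolding * by (rule sums_unique2)
qed

text \<open>All powers from the second on annihilate \<open>v\<close>, so the series stops after its
  linear term.\<close>

lemma cact_exp_of_square_zero:
  assumes "cact x (cact x v) = 0"
  shows "cact (exp x) v = v + cact x v"
proof -
  have 0: "cact (x ^ Suc (Suc k)) v = 0" for k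
    by (induction k) (simp_all add: cact_mult assms)
  have "(\<lambda>k. cact (x ^ k /\<^sub>R fact k) v) sums cact (exp x) v"
    by (rule bounded_linear.sums[OF bounded_linear_cact exp_converges])
  moreover have "cact (x ^ k /\<^sub>R fact k) v = 0" if "k \<notin> {0, 1}" for k
  proof -
    obtain j where "k = Suc (Suc j)"
      using \<open>k \<notin> {0, 1}\<close> by (cases k; cases "k - 1") auto
    then show ?thesis by (simp add: cact_scaleR 0 del: power_Suc)
  qed
  then have "(\<lambda>k. cact (x ^ k /\<^sub>R fact k) v) sums (\<Sum>k\<in>{0, 1}. cact (x ^ k /\<^sub>R fact k) v)"
    by (intro sums_finite) auto
  ultimately have "cact (exp x) v = (\<Sum>k\<in>{0, 1}. cact (x ^ k /\<^sub>R fact k) v)"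
    by (rule sums_unique2)
  then show ?thesis by simp
qed

section \<open>The principal logarithm\<close>

text \<open>The real and imaginary parts of \<open>v\<close> solve the same equation over the reals,
  and one of them is nonzero.\<close>

lemma cact_real_eigenvalue:
  fixes a :: "'n::finite sqmat"
  assumes "cact a v = complex_of_real r *s v" "v \<noteq> 0"
  shows "mat_eigenvalue (mat_of_sq a) r"
proof -
  have c: "map_matrix complex_of_real (mat_of_sq a) *v v = complex_of_real r *s v"
    using assms(1) by (simp add: cact_def)
  define u where "u = (\<chi> i. Re (v $ i))"
  define w where "w = (\<chi> i. Im (v $ i))"
  have u: "mat_of_sq a *v u = r *s u"
  proof -
    have "Re ((map_matrix complex_of_real (mat_of_sq a) *v v) $ i) = Re ((complex_of_real r *s v) $ i)" for i
      by (simp only: c)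
    then show ?thesis
      by (simp add: vec_eq_iff matrix_vector_mult_def u_def)
  qed
  have w: "mat_of_sq a *v w = r *s w"
  proof -
    have "Im ((map_matrix complex_of_real (mat_of_sq a) *v v) $ i) = Im ((complex_of_real r *s v) $ i)" for i
      by (simp only: c)
    then show ?thesis
      by (simp add: vec_eq_iff matrix_vector_mult_def w_def)
  qed
  have "u \<noteq> 0 \<or> w \<noteq> 0"
    using assms(2) by (auto simp: vec_eq_iff complex_eq_iff u_def w_def)
  with u w show ?thesis
    unfolding mat_eigenvalue_def by blast
qed

text \<open>The plane cut along the nonpositive reals is star-shaped about \<open>1\<close>; this is
  the contrapositive.\<close>

lemma segment_from_1_nonpos_Reals_imp:
  assumes "0 \<le> t" "t \<le> 1" "1 + complex_of_real t * (m - 1) \<in> \<real>\<^sub>\<le>\<^sub>0"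
  shows "m \<in> \<real>\<^sub>\<le>\<^sub>0"
proof -
  from assms have *: "1 + t * (Re m - 1) \<le> 0" "t * Im m = 0"
    by (auto simp: complex_nonpos_Reals_iff)
  then have "t > 0"
    using assms by (cases "t = 0") auto
  have "t * Re m \<le> 0"
    using * assms by (simp add: algebra_simps)
  with * \<open>t > 0\<close> show ?thesis
    by (auto simp: complex_nonpos_Reals_iff mult_le_0_iff)
qed

text \<open>The scalar case of the logarithm integral: the segment from \<open>1\<close> to
  \<open>m\<close> avoids the cut, so \<open>Ln\<close> along it is an antiderivative.\<close>

lemma Ln_has_integral:
  assumes "m \<notin> \<real>\<^sub>\<le>\<^sub>0"
  shows "((\<lambda>t. (m - 1) / (1 + complex_of_real t * (m - 1))) has_integral Ln m) {0..1}"
proof -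
  have "((\<lambda>t. (m - 1) / (1 + complex_of_real t * (m - 1))) has_integral
      Ln (1 + complex_of_real 1 * (m - 1)) - Ln (1 + complex_of_real 0 * (m - 1))) {0..1}"
  proof (rule fundamental_theorem_of_calculus)
    fix t :: real assume t: "t \<in> {0..1}"
    then have nr: "1 + complex_of_real t * (m - 1) \<notin> \<real>\<^sub>\<le>\<^sub>0"
      using segment_from_1_nonpos_Reals_imp[of t m] assms by auto
    have "((\<lambda>z. Ln (1 + z * (m - 1))) has_field_derivative (m - 1) / (1 + complex_of_real t * (m - 1)))
        (at (complex_of_real t))"
      using nr by (auto intro!: derivative_eq_intros simp: field_simps)
    then show "((\<lambda>t. Ln (1 + complex_of_real t * (m - 1))) has_vector_derivative
        (m - 1) / (1 + complex_of_real t * (m - 1))) (at t within {0..1})"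
      by (rule has_vector_derivative_real_field[THEN has_vector_derivative_at_within])
  qed simp
  then show ?thesis by simp
qed

text \<open>On a common eigenvector of \<open>x - y\<close> and \<open>y\<close>, the eigenvalues of
  \<open>x\<close> and \<open>y\<close> have equal exponentials and imaginary parts less than
  \<open>2 * pi\<close> apart, so they agree. Thus \<open>x - y\<close> has only the eigenvalue
  \<open>0\<close>, and its exponential is \<open>1\<close>.\<close>

lemma exp_eq_in_strip_imp_eq:
  fixes x y :: "'n::finite sqmat"
  assumes xy: "x * y = y * x" and e: "exp x = exp y"
    and sx: "\<And>v z. v \<noteq> 0 \<Longrightarrow> cact x v = z *s v \<Longrightarrow> \<bar>Im z\<bar> < pi"
    and sy: "\<And>v z. v \<noteq> 0 \<Longrightarrow> cact y v = z *s v \<Longrightarrow> \<bar>Im z\<bar> < pi"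
  shows "x = y"
proof -
  define d where "d = x - y"
  have dy: "d * y = y * d"
    using xy by (simp add: d_def algebra_simps)
  have "exp y * exp d = exp y"
    using exp_add_commuting[of y d] dy e by (simp add: d_def)
  then have "exp (- y) * exp y * exp d = exp (- y) * exp y"
    by (simp add: mult.assoc)
  then have ed: "exp d = 1"
    using exp_minus_inverse[of "- y"] by simp
  have ev: "z = 0" if v: "v \<noteq> 0" "cact d v = z *s v" for z v
  proof -
    obtain w m where w: "w \<noteq> 0" "cact d w = z *s w" "cact y w = m *s w"
      using exists_common_eigenvector[OF dy v] .
    have x: "cact x w = (z + m) *s w"
      using w by (simp add: d_def cact_diff vec_eq_iff algebra_simps)
    have "exp (z + m) *s w = exp m *s w"
      using cact_exp[OF x] cact_exp[OF w(3)] unfolding e by (rule trans[OF sym])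
    then have "exp (z + m) = exp m"
      using w(1) by (auto simp: vec_eq_iff)
    moreover have "\<bar>Im (z + m) - Im m\<bar> < 2 * pi"
      using sx[OF w(1) x] sy[OF w(1,3)] by linarith
    ultimately have "z + m = m"
      by (rule exp_complex_eqI[rotated])
    then show ?thesis by simp
  qed
  \<comment> \<open>Otherwise the image of \<open>d\<close> contains an eigenvector \<open>d u\<close>; then \<open>d\<^sup>2 u = 0\<close> and
    \<open>u = exp d u = u + d u\<close>.\<close>
  have "cact d v = 0" for v
  proof (rule ccontr)
    assume nz: "cact d v \<noteq> 0"
    have "cact d w - l *s w \<in> range (cact d)" if w: "w \<in> range (cact d)" for w l
    proof -
      from w obtain w' where "w = cact d w'" by auto
      then have "cact d w - l *s w = cact d (cact d w' - l *s w')" by simp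
      then show ?thesis by blast
    qed
    then obtain w l where w: "w \<in> range (cact d)" "w \<noteq> 0" "cact d w = l *s w"
      using invariant_set_has_eigenvector[of "range (cact d)" "map_matrix complex_of_real (mat_of_sq d)"
          "cact d v"] nz
      unfolding cact_def[of d, symmetric] by blast
    from w obtain u where u: "w = cact d u" by auto
    have "cact d (cact d u) = 0"
      using ev[OF w(2,3)] w(3) u by simp
    from cact_exp_of_square_zero[OF this] have "cact d u = 0"
      by (simp add: ed)
    with u w(2) show False by simp
  qed
  then have "d = 0" by (rule cact_eqI)
  then show ?thesis by (simp add: d_def)
qed

lemma exists_inverse_diff_scaleR_one:
  assumes "\<not> mat_eigenvalue (mat_of_sq a) r"
  shows "\<exists>b. b * (a - r *\<^sub>R 1) = 1 \<and> (a - r *\<^sub>R 1) * b = 1"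
proof -
  have "\<forall>v. (mat_of_sq a - r *\<^sub>R mat 1) *v v = 0 \<longrightarrow> v = 0"
    using assms unfolding mat_eigenvalue_def
    by (auto simp: matrix_vector_mult_diff_rdistrib scaleR_matrix_vector_assoc [symmetric]
      scalar_mult_eq_scaleR)
  then obtain B where B: "B ** (mat_of_sq a - r *\<^sub>R mat 1) = mat 1"
    using matrix_left_invertible_ker by blast
  then have "(mat_of_sq a - r *\<^sub>R mat 1) ** B = mat 1"
    by (rule matrix_left_right_inverse[THEN iffD1])
  moreover have "mat_of_sq (a - r *\<^sub>R 1) = mat_of_sq a - r *\<^sub>R mat 1"
    by (simp add: minus_sqmat.rep_eq scaleR_sqmat.rep_eq one_sqmat.rep_eq)
  ultimately show ?thesis
    using B by (intro exI[of _ "sq_of_mat B"])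
      (simp add: mat_of_sq_inject[symmetric] times_sqmat.rep_eq one_sqmat.rep_eq sq_of_mat_inverse)
qed

lemma exists_log:
  fixes a :: "'n::finite sqmat"
  assumes nev: "\<And>r. r \<le> 0 \<Longrightarrow> \<not> mat_eigenvalue (mat_of_sq a) r"
  obtains x where "exp x = a" "\<And>v z. v \<noteq> 0 \<Longrightarrow> cact x v = z *s v \<Longrightarrow> \<bar>Im z\<bar> < pi"
    "\<And>y. y * a = a * y \<Longrightarrow> y * x = x * y"
proof -
  have "\<exists>b. b * (1 + t *\<^sub>R (a - 1)) = 1 \<and> (1 + t *\<^sub>R (a - 1)) * b = 1" if t: "t \<in> {0..1}" for t
  proof (cases "t = 0")
    case False
    \<comment> \<open>The segment point at \<open>t\<close> is \<open>t\<close> times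
      \<open>a\<close> minus the scalar \<open>1 - 1 / t\<close>, which is nonpositive and so no
      eigenvalue of \<open>a\<close>.\<close>
    with t have "1 - 1 / t \<le> 0" by simp
    from exists_inverse_diff_scaleR_one[OF nev[OF this]] obtain b where
      b: "b * (a - (1 - 1 / t) *\<^sub>R 1) = 1" "(a - (1 - 1 / t) *\<^sub>R 1) * b = 1"
      by blast
    have "1 + t *\<^sub>R (a - 1) = t *\<^sub>R (a - (1 - 1 / t) *\<^sub>R 1)"
      using False by (simp add: algebra_simps)
    with b False show ?thesis
      by (intro exI[of _ "(1 / t) *\<^sub>R b"]) simp
  qed auto
  then obtain b where b: "\<And>t. t \<in> {0..1} \<Longrightarrow> b t * (1 + t *\<^sub>R (a - 1)) = 1"
      "\<And>t. t \<in> {0..1} \<Longrightarrow> (1 + t *\<^sub>R (a - 1)) * b t = 1"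
    by metis
  obtain x where int: "((\<lambda>t. (a - 1) * b t) has_integral x) {0..1}" and x: "exp x = a"
    and comm: "\<And>y. y * a = a * y \<Longrightarrow> y * x = x * y"
    using exp_log_integral[OF b] by metis
  have "\<bar>Im z\<bar> < pi" if v: "v \<noteq> 0" "cact x v = z *s v" for v z
  proof -
    \<comment> \<open>Commutation moves the eigenvalue \<open>z\<close> to a vector \<open>w\<close>
      that is also an eigenvector of \<open>a\<close>, where the integral can be evaluated.\<close>
    have "x * a = a * x"
      using x exp_times_arg_commute by metis
    then obtain w m where w: "w \<noteq> 0" "cact x w = z *s w" "cact a w = m *s w"
      using exists_common_eigenvector v by metis
    have m: "m \<notin> \<real>\<^sub>\<le>\<^sub>0"
    proof
      assume "m \<in> \<real>\<^sub>\<le>\<^sub>0"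
      then obtain r where "m = complex_of_real r" "r \<le> 0"
        by (auto elim!: nonpos_Reals_cases)
      then show False
        using cact_real_eigenvalue[of a w r] w nev by auto
    qed
    define h where "h t = (m - 1) / (1 + complex_of_real t * (m - 1))" for t
    \<comment> \<open>On \<open>w\<close> the integrand acts as the scalar integrand of
      \<open>Ln m\<close>; comparing the integrals gives \<open>z = Ln m\<close>.\<close>
    have "cact ((a - 1) * b t) w = h t *s w" if t: "t \<in> {0..1}" for t
    proof -
      define c where "c = 1 + complex_of_real t * (m - 1)"
      have "c \<noteq> 0"
        using segment_from_1_nonpos_Reals_imp[of t m] t m unfolding c_def
        by (metis atLeastAtMost_iff nonpos_Reals_zero_I)
      have "w = cact (b t) (cact (1 + t *\<^sub>R (a - 1)) w)"
        using b(1)[OF t] by (metis cact_mult cact_1)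
      also have "cact (1 + t *\<^sub>R (a - 1)) w = c *s w"
        by (simp add: cact_add cact_scaleR cact_diff w c_def vec_eq_iff algebra_simps)
      finally have "w = c *s cact (b t) w" by simp
      then have "(1 / c) *s w = cact (b t) w"
        using \<open>c \<noteq> 0\<close> by (metis divide_self_if mult.commute times_divide_eq_right
          mult.right_neutral vector_smult_assoc vector_smult_lid)
      then have "cact ((a - 1) * b t) w = cact (a - 1) ((1 / c) *s w)"
        by (simp add: cact_mult)
      also have "\<dots> = h t *s w"
        by (simp add: cact_diff w h_def c_def vec_eq_iff algebra_simps diff_divide_distrib)
      finally show ?thesis .
    qed
    moreover have "((\<lambda>t. cact ((a - 1) * b t) w) has_integral cact x w) {0..1}"
      using has_integral_linear[OF int bounded_linear_cact] by (simp add: o_def)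
    ultimately have "((\<lambda>t. h t *s w) has_integral z *s w) {0..1}"
      unfolding w(2) by (rule has_integral_eq)
    moreover have "bounded_linear (\<lambda>c :: complex. c *s w)"
      by (rule linear_conv_bounded_linear[THEN iffD1, OF linearI])
         (simp_all add: vec_eq_iff algebra_simps)
    from has_integral_linear[OF Ln_has_integral[OF m] this]
    have "((\<lambda>t. h t *s w) has_integral Ln m *s w) {0..1}"
      by (simp add: o_def h_def)
    ultimately have "z *s w = Ln m *s w"
      by (rule has_integral_unique)
    then have "z = Ln m"
      using w(1) by (auto simp: vec_eq_iff)
    moreover have "m \<noteq> 0"
      using m by auto
    \<comment> \<open>\<open>Ln\<close> attains the imaginary part \<open>pi\<close> only on the
      negative reals, where \<open>m\<close> does not lie.\<close>
    moreover from this have "Im (Ln m) \<noteq> pi"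
      using m by (auto simp: Im_Ln_eq_pi complex_nonpos_Reals_iff)
    ultimately show ?thesis
      using mpi_less_Im_Ln[of m] Im_Ln_le_pi[of m] by auto
  qed
  with x comm that show ?thesis by blast
qed

text \<open>\<open>exists_log\<close> supplies a candidate for the \<open>THE\<close> and
  \<open>exp_eq_in_strip_imp_eq\<close> excludes a second one.\<close>

lemma mat_exp_principal_log:
  fixes A :: "real^'n::finite^'n"
  assumes nev: "\<And>r. r \<le> 0 \<Longrightarrow> \<not> mat_eigenvalue A r"
  shows "mat_exp (principal_log A) = A"
proof -
  define a where "a = sq_of_mat A"
  have A: "mat_of_sq a = A" by (simp add: a_def sq_of_mat_inverse)
  have exp_iff: "mat_exp X = A \<longleftrightarrow> exp (sq_of_mat X) = a" for X
    by (metis A mat_exp_eq mat_of_sq_inject)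
  have strip_iff: "(\<forall>z. mat_eigenvalue (map_matrix complex_of_real X) z \<longrightarrow> - pi < Im z \<and> Im z < pi)
      \<longleftrightarrow> (\<forall>v z. v \<noteq> 0 \<longrightarrow> cact (sq_of_mat X) v = z *s v \<longrightarrow> \<bar>Im z\<bar> < pi)" for X :: "real^'n^'n"
    by (auto simp: mat_eigenvalue_def cact_def sq_of_mat_inverse abs_less_iff)
  obtain x where x: "exp x = a" "\<And>v z. v \<noteq> 0 \<Longrightarrow> cact x v = z *s v \<Longrightarrow> \<bar>Im z\<bar> < pi"
    "\<And>y. y * a = a * y \<Longrightarrow> y * x = x * y"
    using exists_log[of a] nev unfolding A by blast
  have "mat_exp (principal_log A) = A \<and> (\<forall>z. mat_eigenvalue
      (map_matrix complex_of_real (principal_log A)) z \<longrightarrow> - pi < Im z \<and> Im z < pi)"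
    unfolding principal_log_def
  proof (rule theI)
    show "mat_exp (mat_of_sq x) = A \<and> (\<forall>z. mat_eigenvalue
        (map_matrix complex_of_real (mat_of_sq x)) z \<longrightarrow> - pi < Im z \<and> Im z < pi)"
      unfolding exp_iff strip_iff using x by (simp add: mat_of_sq_inverse)
  next
    fix Y assume Y: "mat_exp Y = A \<and> (\<forall>z. mat_eigenvalue
        (map_matrix complex_of_real Y) z \<longrightarrow> - pi < Im z \<and> Im z < pi)"
    define y where "y = sq_of_mat Y"
    have y: "exp y = a" "\<And>v z. v \<noteq> 0 \<Longrightarrow> cact y v = z *s v \<Longrightarrow> \<bar>Im z\<bar> < pi"
      using Y unfolding exp_iff strip_iff y_def by blast+
    \<comment> \<open>Any candidate \<open>y\<close> commutes with its own exponential
      \<open>a\<close>, and therefore with the constructed \<open>x\<close>.\<close>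
    have "y * x = x * y"
      using y(1) exp_times_arg_commute[of y] by (intro x(3)) simp
    then have "y = x"
      using x(1) y(1) by (intro exp_eq_in_strip_imp_eq[OF \<open>y * x = x * y\<close> _ y(2) x(2)]) simp_all
    then show "Y = mat_of_sq x"
      using sq_of_mat_inverse[of Y] by (simp add: y_def)
  qed
  then show ?thesis by blast
qed

section \<open>Determinants of exponentials\<close>

text \<open>The product rule differentiates one factor of each Leibniz term. A permutation other
  than \<open>id\<close> moves at least two indices, so another factor is still \<open>0\<close>;
  \<open>id\<close> contributes the trace.\<close>

lemma has_real_derivative_det_at_identity:
  fixes M :: "real \<Rightarrow> real^'n^'n"
  assumes M0: "M 0 = mat 1"
    and dM: "\<And>i j. ((\<lambda>t. M t $ i $ j) has_real_derivative A $ i $ j) (at 0)"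
  shows "((\<lambda>t. det (M t)) has_real_derivative trace A) (at 0)"
proof -
  let ?P = "{p. p permutes (UNIV :: 'n set)}"
  let ?d = "\<lambda>p. of_int (sign p) * (\<Sum>i\<in>UNIV. A $ i $ p i * (\<Prod>j\<in>UNIV - {i}. M 0 $ j $ p j))"
  have "((\<lambda>t. det (M t)) has_real_derivative (\<Sum>p\<in>?P. ?d p)) (at 0)"
    unfolding det_def
    by (intro DERIV_sum DERIV_cmult has_field_derivative_prod) (use dM in simp)
  moreover have "?d p = 0" if p: "p \<in> ?P" "p \<noteq> id" for p
  proof -
    have "(\<Prod>j\<in>UNIV - {i}. M 0 $ j $ p j) = 0" for i
    proof -
      have inj: "inj p"
        using p permutes_inj by blast
      obtain k where k: "p k \<noteq> k"
        using p(2) by (auto simp: fun_eq_iff)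
      obtain j where "j \<noteq> i" "j \<noteq> p j"
      \<comment> \<open>If the moved index is the differentiated one, injectivity makes
        \<open>p i\<close> a second moved index.\<close>
      proof (cases "k = i")
        case True
        with k inj have "p (p i) \<noteq> p i"
          by (auto dest: injD)
        with k True show ?thesis using that[of "p i"] by auto
      qed (use k that[of k] in auto)
      then have "j \<in> UNIV - {i}" "(mat 1 :: real^'n^'n) $ j $ p j = 0"
        by (simp_all add: mat_def)
      then show ?thesis
        unfolding M0 by (intro prod_zero) auto
    qed
    then show ?thesis
      by (simp only: mult_zero_right sum.neutral_const)
  qed
  then have "(\<Sum>p\<in>?P. ?d p) = (\<Sum>p\<in>{id}. ?d p)"
    by (intro sum.mono_neutral_right) (auto simp: permutes_id finite_permutations)
  moreover have "(\<Sum>p\<in>{id}. ?d p) = trace A"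
    by (simp add: M0 trace_def mat_def)
  ultimately show ?thesis by simp
qed

text \<open>Along \<open>t *\<^sub>R a\<close> the determinant \<open>g\<close> is multiplicative in
  \<open>t\<close> and has derivative \<open>trace A\<close> at \<open>0\<close>. So
  \<open>g\<close> solves a linear differential equation, and
  \<open>g t * exp (- (t * trace A))\<close> is constant.\<close>

lemma det_mat_exp: "det (mat_exp A) = exp (trace A)"
proof -
  define a where "a = sq_of_mat A"
  define g where "g t = det (mat_of_sq (exp (t *\<^sub>R a)))" for t
  have g0: "g 0 = 1"
    by (simp add: g_def one_sqmat.rep_eq)
  have g_add: "g (s + t) = g s * g t" for s t
    unfolding g_def scaleR_add_left
    by (subst exp_add_commuting) (simp_all add: times_sqmat.rep_eq det_mul)
  have "((\<lambda>t. exp (t *\<^sub>R a)) has_vector_derivative a) (at 0)"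
    using exp_scaleR_has_vector_derivative_right[of a 0 UNIV] by simp
  then have "((\<lambda>t. mat_of_sq (exp (t *\<^sub>R a))) has_vector_derivative A) (at 0)"
    using bounded_linear.has_vector_derivative[OF bounded_linear_mat_of_sq]
    by (fastforce simp: a_def sq_of_mat_inverse)
  then have "((\<lambda>t. mat_of_sq (exp (t *\<^sub>R a)) $ i $ j) has_real_derivative A $ i $ j) (at 0)" for i j
    using bounded_linear.has_vector_derivative[OF bounded_linear_vec_nth[of j],
        OF bounded_linear.has_vector_derivative[OF bounded_linear_vec_nth[of i]]]
    by (simp add: has_real_derivative_iff_has_vector_derivative)
  then have dg0: "(g has_real_derivative trace A) (at 0)"
    unfolding g_def by (intro has_real_derivative_det_at_identity) (auto simp: one_sqmat.rep_eq)
  have dg: "(g has_real_derivative g t * trace A) (at t)" for t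
  proof -
    have "((\<lambda>h. g t * g h) has_real_derivative g t * trace A) (at 0)"
      by (intro DERIV_cmult dg0)
    then show ?thesis
      using DERIV_shift[of g "g t * trace A" 0 t] by (simp add: g_add mult.commute)
  qed
  have "((\<lambda>t. g t * exp (- (t * trace A))) has_real_derivative 0) (at t)" for t
    by (auto intro!: derivative_eq_intros dg)
  then have "g 1 * exp (- (1 * trace A)) = g 0 * exp (- (0 * trace A))"
    by (intro DERIV_isconst_all) blast
  then have "g 1 = exp (trace A)"
    by (simp add: g0 exp_minus field_simps)
  then show ?thesis
    by (simp add: g_def a_def mat_exp_eq)
qed

lemma trace_sum: "trace (\<Sum>i\<in>I. f i) = (\<Sum>i\<in>I. trace (f i))"
  by (induction I rule: infinite_finite_induct) (simp_all add: trace_def sum.distrib)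

lemma trace_scaleR: "trace (r *\<^sub>R A) = r * trace A" for A :: "real^'n^'n"
  by (simp add: trace_def sum_distrib_left)

text \<open>The \<open>X i\<close> need not commute, so the exponential itself need not factor; its
  determinant does, because the trace is linear.\<close>

lemma det_mat_exp_sum:
  fixes X :: "'i \<Rightarrow> real^'n^'n"
  assumes "finite I"
  shows "det (mat_exp (\<Sum>i\<in>I. c i *\<^sub>R X i)) = (\<Prod>i\<in>I. det (mat_exp (X i)) powr c i)"
  using assms by (simp add: det_mat_exp trace_sum trace_scaleR exp_sum powr_def)

section \<open>The determinant of the interpolant\<close>

lemma det_J_mat: "det (J_mat p :: real^'n::{finite,linorder}^'n::{finite,linorder}) \<in> {-1, 1}"
proof -
  have "det (J_mat p :: real^'n::{finite,linorder}^'n::{finite,linorder}) = (\<Prod>i\<in>UNIV. if card {k. k < (i::'n)} < p then -1 else 1)"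
    by (subst det_diagonal) (auto simp: J_mat_def)
  moreover have "(\<Prod>i\<in>I. if P i then -1 else 1 :: real) \<in> {-1, 1}" for I :: "'n set" and P
    by (induction I rule: infinite_finite_induct) auto
  ultimately show ?thesis by simp
qed

theorem lemma4p3:
  fixes \<Omega> :: "(real^'d) set"
    and xs :: "nat \<Rightarrow> real^'d"
    and \<phi> :: "nat \<Rightarrow> real^'d \<Rightarrow> real"
    and L :: "nat \<Rightarrow> real^'n::{finite,linorder}^'n::{finite,linorder}"
    and p q m :: nat
  assumes "p + q = CARD('n)"
    and "open \<Omega>" "connected \<Omega>" "\<Omega> \<noteq> {}"
    and "\<And>i. i \<in> {1..m} \<Longrightarrow> xs i \<in> \<Omega>"
    and "\<And>i j. i \<in> {1..m} \<Longrightarrow> j \<in> {1..m} \<Longrightarrow> \<phi> i (xs j) = (if i = j then 1 else 0)"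
    and "\<And>i. i \<in> {1..m} \<Longrightarrow> L i \<in> sig_matrices_star p q"
    and "\<And>x. x \<in> \<Omega> \<Longrightarrow> (\<Sum>i=1..m. \<phi> i x) = 1"
  shows "\<forall>x\<in>\<Omega>. complex_of_real (det (interpolant p m \<phi> L x)) =
    (\<Prod>i=1..m. complex_of_real (det (L i)) powr complex_of_real (\<phi> i x))"
proof
  fix x assume x: "x \<in> \<Omega>"
  define J where "J = (J_mat p :: real^'n::{finite,linorder}^'n::{finite,linorder})"
  have J: "det J = 1 \<or> det J = -1"
    using det_J_mat[of p] by (auto simp: J_def)
  \<comment> \<open>Invertibility excludes the eigenvalue \<open>0\<close> of
    \<open>L i ** J\<close>, membership in \<open>sig_matrices_star\<close> the negative
    ones.\<close>
  have log: "mat_exp (principal_log (L i ** J)) = L i ** J" if i: "i \<in> {1..m}" for i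
  proof (rule mat_exp_principal_log)
    fix r :: real assume "r \<le> 0"
    have L: "invertible (L i)" "\<And>l. l < 0 \<Longrightarrow> \<not> mat_eigenvalue (L i ** J) l"
      using assms(7)[OF i] by (auto simp: sig_matrices_star_def sig_matrices_def J_def)
    have "invertible (L i ** J)"
      using L(1) J by (auto simp: invertible_det_nz det_mul)
    then have "\<not> mat_eigenvalue (L i ** J) 0"
      by (simp add: mat_eigenvalue_def) (metis invertible_def matrix_left_invertible_ker)
    with L(2) \<open>r \<le> 0\<close> show "\<not> mat_eigenvalue (L i ** J) r"
      by (cases "r = 0") auto
  qed
  \<comment> \<open>\<open>L i ** J\<close> is an exponential, so its determinant is positive:
    \<open>det (L i)\<close> has the sign of \<open>det J\<close>.\<close>
  have pos: "det (L i) * det J > 0" if "i \<in> {1..m}" for i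
    using log[OF that] det_mat_exp[of "principal_log (L i ** J)"] by (simp add: det_mul)
  have "det (interpolant p m \<phi> L x) = (\<Prod>i=1..m. (det (L i) * det J) powr \<phi> i x) * det J"
    unfolding interpolant_def J_def[symmetric] det_mul det_mat_exp_sum[OF finite_atLeastAtMost]
    by (simp add: log det_mul)
  also have "complex_of_real \<dots> =
    (\<Prod>i=1..m. complex_of_real (det (L i)) powr complex_of_real (\<phi> i x))"
    using J
  proof
    assume "det J = 1"
    with pos show ?thesis
      by (simp add: complex_powr_of_pos)
  next
    \<comment> \<open>Each principal power of the negative \<open>det (L i)\<close> carries the
      phase \<open>exp (\<i> * pi * \<phi> i x)\<close>. As the weights sum to \<open>1\<close>, the
      phases multiply to \<open>exp (\<i> * pi) = -1\<close>, which is the factor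
      \<open>det J\<close>.\<close>
    assume d: "det J = -1"
    have neg: "det (L i) < 0" if "i \<in> {1..m}" for i
      using pos[OF that] d by simp
    have "(\<Prod>i=1..m. complex_of_real (det (L i)) powr complex_of_real (\<phi> i x)) =
      (\<Prod>i=1..m. complex_of_real ((- det (L i)) powr \<phi> i x)) *
      (\<Prod>i=1..m. exp (\<i> * complex_of_real pi * complex_of_real (\<phi> i x)))"
      unfolding prod.distrib[symmetric]
    proof (rule prod.cong)
      fix i assume "i \<in> {1..m}"
      from neg[OF this] show "complex_of_real (det (L i)) powr complex_of_real (\<phi> i x) =
        complex_of_real ((- det (L i)) powr \<phi> i x) * exp (\<i> * complex_of_real pi * complex_of_real (\<phi> i x))"
        by (simp add: complex_powr_of_neg)
    qed simp
    also have "(\<Prod>i=1..m. exp (\<i> * complex_of_real pi * complex_of_real (\<phi> i x))) =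
      exp (\<i> * complex_of_real pi * complex_of_real (\<Sum>i=1..m. \<phi> i x))"
      by (simp add: exp_sum sum_distrib_left)
    also have "\<dots> = -1"
      using assms(8)[OF x] by simp
    finally show ?thesis
      by (simp add: d)
  qed
  finally show "complex_of_real (det (interpolant p m \<phi> L x)) =
    (\<Prod>i=1..m. complex_of_real (det (L i)) powr complex_of_real (\<phi> i x))" .
qed

end
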